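(* Let $X$ be an infinite set. For every infinite discrete space $Y$ with $|Y| \leq 2^{|X|}$, the space $Top(X)$ contains a subspace homeomorphic to the one-point compactification of $Y$.
   Context: $2^{\mathcal{P}(X)}$ is the set $\mathcal{P}(\mathcal{P}(X))$ of all families of subsets of $X$ with the product topology ($2=\{0,1\}$ discrete). $Top(X) \subseteq 2^{\mathcal{P}(X)}$ is the set of all topologies on $X$, with the subspace topology. *)

theory Defs
  imports "HOL-Analysis.Analysis"
begin

(* A family F of subsets of X is identified with its characteristic function on Pow X;
   restrict makes that function a point of the library's (extensional) product. *)
definition char_fun :: "'a set \<Rightarrow> 'a set set \<Rightarrow> 'a set \<Rightarrow> bool" where
  "char_fun X F = restrict (\<lambda>A. A \<in> F) (Pow X)"

(* 2^(Pow X), carried by families of subsets of X. *)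
definition family_space :: "'a set \<Rightarrow> 'a set set topology" where
  "family_space X =
     pullback_topology (Pow (Pow X)) (char_fun X)
       (product_topology (\<lambda>_. discrete_topology (UNIV :: bool set)) (Pow X))"

definition topologies_on :: "'a set \<Rightarrow> 'a set set set" where
  "topologies_on X = {Collect (openin T) | T. topspace T = X}"

definition Top :: "'a set \<Rightarrow> 'a set set topology" where
  "Top X = subtopology (family_space X) (topologies_on X)"

lemma image_vimage_Int_eq: "U \<subseteq> f ` A \<Longrightarrow> f ` (f -` U \<inter> A) = U"
  by auto

lemma homeomorphic_map_char_fun:
  "homeomorphic_map (family_space X)
     (product_topology (\<lambda>_. discrete_topology (UNIV :: bool set)) (Pow X)) (char_fun X)"
proof -
  let ?P = "product_topology (\<lambda>_. discrete_topology (UNIV :: bool set)) (Pow X)"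
  have into: "char_fun X F \<in> topspace ?P" for F
    unfolding char_fun_def topspace_product_topology topspace_discrete_topology
    by (simp only: PiE_iff restrict_extensional UNIV_I simp_thms) (rule ballI, rule TrueI)
  have sp: "topspace (family_space X) = Pow (Pow X)"
    unfolding family_space_def topspace_pullback_topology
    by (rule Int_absorb1) (rule subsetI, rule vimageI2, rule into)
  have inj: "inj_on (char_fun X) (Pow (Pow X))"
  proof (rule inj_onI)
    fix F G assume FG: "F \<in> Pow (Pow X)" "G \<in> Pow (Pow X)" and eq: "char_fun X F = char_fun X G"
    have "A \<in> F \<longleftrightarrow> A \<in> G" for A
    proof (cases "A \<in> Pow X")
      case True
      then show ?thesis
        using fun_cong[OF eq, of A] by (simp only: char_fun_def restrict_apply if_True)
    next
      case False
      with FG have "A \<notin> F" "A \<notin> G" by blast+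
      then show ?thesis by simp
    qed
    then show "F = G"
      by (rule set_eqI)
  qed
  have surj: "f \<in> char_fun X ` Pow (Pow X)" if "f \<in> topspace ?P" for f
  proof (rule image_eqI)
    have ext: "f \<in> extensional (Pow X)"
      using that unfolding topspace_product_topology PiE_iff by (rule conjunct2)
    show "f = char_fun X {A \<in> Pow X. f A}"
    proof (rule extensionalityI[OF ext])
      show "char_fun X {A \<in> Pow X. f A} \<in> extensional (Pow X)"
        unfolding char_fun_def by (rule restrict_extensional)
      show "f A = char_fun X {A \<in> Pow X. f A} A" if "A \<in> Pow X" for A
        using that by (simp only: char_fun_def restrict_apply mem_Collect_eq if_True simp_thms)
    qed
    show "{A \<in> Pow X. f A} \<in> Pow (Pow X)"
      by blast
  qed
  have img: "char_fun X ` Pow (Pow X) = topspace ?P"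
  proof (rule equalityI)
    show "char_fun X ` Pow (Pow X) \<subseteq> topspace ?P"
      by (rule image_subsetI) (rule into)
    show "topspace ?P \<subseteq> char_fun X ` Pow (Pow X)"
      using surj by (rule subsetI)
  qed
  have cont: "continuous_map (family_space X) ?P (char_fun X)"
    unfolding family_space_def using continuous_map_pullback[OF continuous_map_id[of ?P]]
    by (simp only: id_comp)
  have opn: "open_map (family_space X) ?P (char_fun X)"
    unfolding open_map_def
  proof (intro allI impI)
    fix S assume "openin (family_space X) S"
    then obtain U where U: "openin ?P U" and S: "S = char_fun X -` U \<inter> Pow (Pow X)"
      unfolding family_space_def openin_pullback_topology by (elim exE conjE) (rule that)
    have "U \<subseteq> char_fun X ` Pow (Pow X)"
      unfolding img using U by (rule openin_subset)
    then have "char_fun X ` S = U"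
      unfolding S by (rule image_vimage_Int_eq)
    with U show "openin ?P (char_fun X ` S)" by (simp only:)
  qed
  show ?thesis
    by (rule bijective_open_imp_homeomorphic_map[OF cont opn]) (simp_all only: sp img inj)
qed

lemma topologies_on_alt:
  "\<tau> \<in> topologies_on X \<longleftrightarrow>
     \<tau> \<subseteq> Pow X \<and> {} \<in> \<tau> \<and> X \<in> \<tau> \<and> (\<forall>A\<in>\<tau>. \<forall>B\<in>\<tau>. A \<inter> B \<in> \<tau>) \<and> (\<forall>K\<subseteq>\<tau>. \<Union>K \<in> \<tau>)"
  (is "_ \<longleftrightarrow> ?R")
proof
  assume "\<tau> \<in> topologies_on X"
  then obtain T where T: "\<tau> = Collect (openin T)" "topspace T = X"
    unfolding topologies_on_def by blast
  have "\<tau> \<subseteq> Pow X"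
    using openin_subset[of T] T by blast
  moreover have "{} \<in> \<tau>" "X \<in> \<tau>"
    using openin_empty[of T] openin_topspace[of T] T by simp_all
  moreover have "A \<inter> B \<in> \<tau>" if "A \<in> \<tau>" "B \<in> \<tau>" for A B
    using that T(1) openin_Int[of T A B] by simp
  moreover have "\<Union>K \<in> \<tau>" if "K \<subseteq> \<tau>" for K
  proof -
    have "openin T (\<Union>K)"
      by (rule openin_Union) (use that T(1) in blast)
    then show ?thesis
      by (simp add: T(1))
  qed
  ultimately show ?R
    by simp
next
  assume R: ?R
  have "istopology (\<lambda>A. A \<in> \<tau>)"
    unfolding istopology_def
  proof (intro conjI allI impI)
    show "A \<inter> B \<in> \<tau>" if "A \<in> \<tau>" "B \<in> \<tau>" for A B
      using R that by blast
    show "\<Union>K \<in> \<tau>" if "\<forall>A\<in>K. A \<in> \<tau>" for K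
    proof -
      have "K \<subseteq> \<tau>" using that by blast
      with R show ?thesis by simp
    qed
  qed
  then have op: "openin (topology (\<lambda>A. A \<in> \<tau>)) = (\<lambda>A. A \<in> \<tau>)"
    by (rule topology_inverse')
  have "topspace (topology (\<lambda>A. A \<in> \<tau>)) = \<Union>\<tau>"
    unfolding topspace_def op by simp
  also have "\<dots> = X"
  proof (rule equalityI)
    show "\<Union>\<tau> \<subseteq> X" by (rule Sup_least) (use R in blast)
    show "X \<subseteq> \<Union>\<tau>" by (rule Union_upper) (rule R[THEN conjunct2, THEN conjunct2, THEN conjunct1])
  qed
  finally have "topspace (topology (\<lambda>A. A \<in> \<tau>)) = X" .
  moreover have "\<tau> = Collect (openin (topology (\<lambda>A. A \<in> \<tau>)))"
    unfolding op by simp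
  ultimately show "\<tau> \<in> topologies_on X"
    unfolding topologies_on_def by blast
qed

end

theory Submission
  imports Defs
begin

text \<open>
  The points of the subspace are the coarsest topologies containing one prescribed set:
  for \<open>A\<close> different from \<open>{}\<close> and \<open>X\<close> the family \<open>{{}, A, X}\<close> is a topology on \<open>X\<close>. A basic
  neighbourhood of the indiscrete topology \<open>{{}, X}\<close> only forbids finitely many sets, so it contains
  \<open>{{}, A, X}\<close> for all but finitely many \<open>A\<close>; on the other hand the
  condition that \<open>A\<close> belongs to the family isolates \<open>{{}, A, X}\<close> among these topologies. The
  indiscrete topology is therefore the point at infinity of the one-point compactification of the
  discrete set of all \<open>{{}, A, X}\<close>. Since \<open>X\<close> is infinite, dropping \<open>{}\<close> and \<open>X\<close> from
  \<open>Pow X\<close> does not change its cardinality, so the set \<open>Y\<close> can be embedded among the remaining \<open>A\<close>.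

  Formally, a map into the product is continuous as soon as membership of each single set is a
  clopen condition (\<open>continuous_map_into_family_space\<close>), and a continuous injection of a
  compact space into the Hausdorff space \<open>Top X\<close> is an embedding.
\<close>

lemma Hausdorff_space_family_space: "Hausdorff_space (family_space X)"
  using homeomorphic_Hausdorff_space
    [OF homeomorphic_map_imp_homeomorphic_space[OF homeomorphic_map_char_fun[of X]]]
  by (simp add: Hausdorff_space_product_topology)

lemma Hausdorff_space_Top: "Hausdorff_space (Top X)"
  by (simp add: Top_def Hausdorff_space_subtopology Hausdorff_space_family_space)

lemma topspace_Top: "topspace (Top X) = topologies_on X"
proof -
  have "topologies_on X \<subseteq> Pow (Pow X)"
    by (rule subsetI, rule PowI) (simp only: topologies_on_alt)
  moreover have "char_fun X -` topspace
      (product_topology (\<lambda>_. discrete_topology (UNIV :: bool set)) (Pow X)) = UNIV"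
    by (simp add: char_fun_def vimage_def)
  then have "topspace (family_space X) = Pow (Pow X)"
    by (simp add: family_space_def topspace_pullback_topology)
  ultimately show ?thesis
    by (simp add: Top_def Int_absorb1)
qed

text \<open>
  The topology is the one pulled back from a product of two-point discrete spaces along
  characteristic functions, so continuity can be tested coordinatewise, and a map to the discrete
  space \<open>bool\<close> is continuous when the preimage of \<open>True\<close> is clopen.
\<close>

lemma continuous_map_into_family_space:
  assumes into: "\<And>z. z \<in> topspace Z \<Longrightarrow> g z \<subseteq> Pow X"
    and clopen: "\<And>A. A \<subseteq> X \<Longrightarrow> openin Z {z \<in> topspace Z. A \<in> g z}"
      "\<And>A. A \<subseteq> X \<Longrightarrow> closedin Z {z \<in> topspace Z. A \<in> g z}"
  shows "continuous_map Z (family_space X) g"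
  unfolding family_space_def
proof (rule continuous_map_pullback')
  have "continuous_map Z (discrete_topology UNIV) (\<lambda>z. A \<in> g z)" if A: "A \<subseteq> X" for A
    unfolding continuous_map_def
  proof (intro conjI allI impI)
    fix U :: "bool set"
    have "openin Z (topspace Z - {z \<in> topspace Z. A \<in> g z})"
      using clopen(2)[OF A] by (simp add: closedin_def)
    moreover have "{z \<in> topspace Z. (A \<in> g z) \<in> U} =
        (if True \<in> U then {z \<in> topspace Z. A \<in> g z} else {}) \<union>
        (if False \<in> U then topspace Z - {z \<in> topspace Z. A \<in> g z} else {})"
      by (rule set_eqI, rename_tac z, case_tac "A \<in> g z") simp_all
    ultimately show "openin Z {z \<in> topspace Z. (A \<in> g z) \<in> U}"
      using clopen(1)[OF A] by (simp add: openin_Un)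
  qed simp
  then show "continuous_map Z (product_topology (\<lambda>_. discrete_topology (UNIV :: bool set)) (Pow X))
      (char_fun X \<circ> g)"
    by (auto simp: continuous_map_componentwise char_fun_def image_subset_iff o_def)
  show "topspace Z \<subseteq> g -` Pow (Pow X)"
    using into by auto
qed

lemma three_set_family_in_topologies_on:
  assumes "A \<subseteq> X"
  shows "{{}, A, X} \<in> topologies_on X"
  unfolding topologies_on_alt
proof (intro conjI allI impI)
  show "\<Union>K \<in> {{}, A, X}" if "K \<subseteq> {{}, A, X}" for K
  proof -
    have "X \<in> K \<or> A \<in> K \<and> X \<notin> K \<or> K \<subseteq> {{}}"
      using that by blast
    then show ?thesis
    proof (elim disjE)
      assume "X \<in> K"
      then have "\<Union>K = X"
        using that assms by blast
      then show ?thesis by simp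
    next
      assume "A \<in> K \<and> X \<notin> K"
      then have "\<Union>K = A"
        using that by blast
      then show ?thesis by simp
    next
      assume "K \<subseteq> {{}}"
      then have "\<Union>K = {}"
        by blast
      then show ?thesis by simp
    qed
  qed
qed (use assms in auto)

lemma clopen_finite_Some_image_Alexandroff_discrete:
  assumes "finite C" "C \<subseteq> Y"
  shows "openin (Alexandroff_compactification (discrete_topology Y)) (Some ` C)"
    and "closedin (Alexandroff_compactification (discrete_topology Y)) (Some ` C)"
  using assms by (simp_all add: compactin_discrete_topology)

lemma Pow_lepoll_proper_nonempty_subsets:
  assumes "infinite X"
  shows "Pow X \<lesssim> Pow X - {{}, X}"
proof -
  have inf: "infinite (Pow X - {{}, X})"
    using assms by (simp add: finite_Pow_iff)
  have "Pow X = insert {} (insert X (Pow X - {{}, X}))"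
    by auto
  also have "\<dots> \<approx> insert X (Pow X - {{}, X})"
    using inf by (intro infinite_insert_eqpoll) simp
  also have "\<dots> \<approx> Pow X - {{}, X}"
    using inf by (rule infinite_insert_eqpoll)
  finally show ?thesis
    by (rule eqpoll_imp_lepoll)
qed

theorem corollary5p6:
  fixes X :: "'a set" and Y :: "'b set"
  assumes "infinite X"
    and "infinite Y"
    and "Y \<lesssim> Pow X"
  shows "\<exists>S. S \<subseteq> topspace (Top X) \<and>
    subtopology (Top X) S homeomorphic_space Alexandroff_compactification (discrete_topology Y)"
proof -
  let ?Z = "Alexandroff_compactification (discrete_topology Y)"
  obtain f where f: "inj_on f Y" "f ` Y \<subseteq> Pow X - {{}, X}"
    using lepoll_trans[OF assms(3) Pow_lepoll_proper_nonempty_subsets[OF assms(1)]]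
    by (auto simp: lepoll_def)
  \<comment> \<open>At the point at infinity the middle set is \<open>{}\<close>, which yields the indiscrete topology.\<close>
  define g where "g z = {{}, case z of None \<Rightarrow> {} | Some y \<Rightarrow> f y, X}" for z
  have g_top: "g z \<in> topologies_on X" if "z \<in> topspace ?Z" for z
    unfolding g_def
    by (rule three_set_family_in_topologies_on) (use that f(2) in \<open>auto split: option.split\<close>)
  have clopen: "openin ?Z {z \<in> topspace ?Z. A \<in> g z} \<and> closedin ?Z {z \<in> topspace ?Z. A \<in> g z}"
    for A
  proof (cases "A \<in> {{}, X}")
    case True
    then have "{z \<in> topspace ?Z. A \<in> g z} = topspace ?Z"
      by (auto simp: g_def)
    then show ?thesis
      by (simp only: openin_topspace closedin_topspace simp_thms)
  next
    case False
    let ?C = "{y \<in> Y. f y = A}"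
    have "{z \<in> topspace ?Z. A \<in> g z} = Some ` ?C"
      using False by (auto simp: g_def)
    moreover have "finite ?C"
    proof (rule finite_subset)
      show "?C \<subseteq> {inv_into Y f A}"
        using f(1) by auto
    qed simp
    ultimately show ?thesis
      using clopen_finite_Some_image_Alexandroff_discrete[of ?C Y] by simp
  qed
  have "continuous_map ?Z (family_space X) g"
  proof (rule continuous_map_into_family_space)
    show "g z \<subseteq> Pow X" if "z \<in> topspace ?Z" for z
      using g_top[OF that] by (simp add: topologies_on_alt)
  qed (use clopen in blast)+
  then have "continuous_map ?Z (Top X) g"
    using g_top by (auto simp: Top_def continuous_map_in_subtopology)
  moreover have "inj_on g (topspace ?Z)"
  proof (rule inj_on_inverseI)
    \<comment> \<open>The index of a family is read off from its elements other than \<open>{}\<close> and \<open>X\<close>.\<close>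
    let ?h = "\<lambda>F. if F - {{}, X} = {} then None else Some (inv_into Y f (the_elem (F - {{}, X})))"
    show "?h (g z) = z" if "z \<in> topspace ?Z" for z
    proof (cases z)
      case None
      then show ?thesis by (simp add: g_def)
    next
      case (Some y)
      with that f(2) have "y \<in> Y" "g z - {{}, X} = {f y}"
        by (auto simp: g_def)
      with Some f(1) show ?thesis by simp
    qed
  qed
  ultimately have "embedding_map ?Z (Top X) g"
    by (intro continuous_imp_embedding_map) (simp_all add: Hausdorff_space_Top)
  then have "subtopology (Top X) (g ` topspace ?Z) homeomorphic_space ?Z"
    using embedding_map_imp_homeomorphic_space homeomorphic_space_sym by blast
  moreover have "g ` topspace ?Z \<subseteq> topspace (Top X)"
    unfolding topspace_Top using g_top by (rule image_subsetI)
  ultimately show ?thesis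
    by blast
qed

end
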